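(* Let $q=2^r$ and let $\psi$ be any nontrivial additive character of $\mathbb{F}_q$. Then $$\sum_{w\in SO^+(2,q)}\psi(\mathrm{Tr}\,w)=K(\psi;1),\qquad \sum_{w\in O^+(2,q)}\psi(\mathrm{Tr}\,w)=K(\psi;1)+q-1,$$ $$\sum_{w\in SO^+(4,q)}\psi(\mathrm{Tr}\,w)=q^2\big(K(\psi;1)^2+q^3-q\big).$$
   Context: $K(\psi;a)=\sum_{\alpha\in\mathbb{F}_q^*}\psi(\alpha+a\alpha^{-1})$ for $a\in\mathbb{F}_q^*$. $\mathrm{Tr}$ is the matrix trace. On column vectors $x\in\mathbb{F}_q^{2n}$ let $\theta^+(x)=\sum_{i=1}^n x_ix_{n+i}$; $O^+(2n,q)$ is the group of $g\in GL(2n,q)$ preserving $\theta^+$; equivalently, writing $g=\begin{bmatrix}A&B\\C&D\end{bmatrix}$ with $n\times n$ blocks, ${}^tAC,{}^tBD$ are alternating (symmetric with zero diagonal) and ${}^tAD+{}^tCB=1_n$. The map $\delta^+(g)=\mathrm{Tr}(B\,{}^tC)$ is a surjective homomorphism $O^+(2n,q)\to\mathbb{F}_2$ and $SO^+(2n,q)=\ker\delta^+$. *)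

theory Defs
  imports "HOL-Analysis.Analysis"
begin

definition additive_character :: "('a::ab_group_add \<Rightarrow> complex) \<Rightarrow> bool" where
  "additive_character \<psi> \<longleftrightarrow> (\<forall>x. \<psi> x \<noteq> 0) \<and> (\<forall>x y. \<psi> (x + y) = \<psi> x * \<psi> y)"

definition nontrivial_additive_character :: "('a::ab_group_add \<Rightarrow> complex) \<Rightarrow> bool" where
  "nontrivial_additive_character \<psi> \<longleftrightarrow> additive_character \<psi> \<and> (\<exists>x. \<psi> x \<noteq> 1)"

definition kloosterman_sum :: "('a::{field,finite} \<Rightarrow> complex) \<Rightarrow> 'a \<Rightarrow> complex" where
  "kloosterman_sum \<psi> a = (\<Sum>\<alpha>\<in>UNIV - {0}. \<psi> (\<alpha> + a * inverse \<alpha>))"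

text \<open>
  With \<open>n = CARD('n)\<close>, coordinates of a vector of length \<open>2n\<close> are indexed by \<open>'n + 'n\<close>:
  \<open>Inl i\<close> stands for the index \<open>i\<close> and \<open>Inr i\<close> for the index \<open>n + i\<close>.
\<close>

definition theta_plus :: "'a::field ^ ('n::finite + 'n) \<Rightarrow> 'a" where
  "theta_plus x = (\<Sum>i\<in>UNIV. x $ Inl i * x $ Inr i)"

definition O_plus :: "('a::field ^ ('n::finite + 'n) ^ ('n + 'n)) set" where
  "O_plus = {g. invertible g \<and> (\<forall>x. theta_plus (g *v x) = theta_plus x)}"

definition block_B :: "'a ^ ('n::finite + 'n) ^ ('n + 'n) \<Rightarrow> 'a ^ 'n ^ 'n" where
  "block_B g = (\<chi> i j. g $ Inl i $ Inr j)"

definition block_C :: "'a ^ ('n::finite + 'n) ^ ('n + 'n) \<Rightarrow> 'a ^ 'n ^ 'n" where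
  "block_C g = (\<chi> i j. g $ Inr i $ Inl j)"

text \<open>
  In characteristic 2 this takes values in the prime field \<open>{0, 1}\<close> on \<^const>\<open>O_plus\<close>; the group
  of order 2 is thus viewed inside the field.
\<close>

definition delta_plus :: "'a::field ^ ('n::finite + 'n) ^ ('n + 'n) \<Rightarrow> 'a" where
  "delta_plus g = trace (block_B g ** transpose (block_C g))"

definition SO_plus :: "('a::field ^ ('n::finite + 'n) ^ ('n + 'n)) set" where
  "SO_plus = {g \<in> O_plus. delta_plus g = 0}"

end

theory Submission
  imports Defs
begin

text \<open>
  For \<open>n = 2\<close> identify a vector \<open>(x1, x2, y1, y2)\<close> with the two-by-two matrix with rows
  \<open>(x1, x2)\<close> and \<open>(y2, y1)\<close>. In characteristic 2 the form becomes the determinant, so the isometries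
  are the maps \<open>X \<mapsto> g X h\<close> and \<open>X \<mapsto> g X\<^sup>t h\<close>; since every field element is a square, \<open>g\<close> and \<open>h\<close>
  can be taken of determinant 1 and are then unique. The first kind has \<open>\<delta> = 0\<close>, the second \<open>\<delta> = 1\<close>,
  and the trace of \<open>X \<mapsto> g X h\<close> is \<open>tr g \<cdot> tr h\<close>. The sum over \<open>SO\<^sup>+(4,q)\<close> is therefore a double sum
  over \<open>SL(2,q)\<close>, which is evaluated from
  \<open>\<Sum>\<^sub>g F (tr g) = (q\<^sup>2 - q) \<Sum>\<^sub>t F t + q \<Sum>\<^sub>x F (x + 1/x)\<close> and from
  \<open>(x + 1/x) (y + 1/y) = (u + 1/u) + (v + 1/v)\<close> with \<open>u = x y\<close> and \<open>v = x / y\<close>, where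
  \<open>(x, y) \<mapsto> (u, v)\<close> is a bijection in characteristic 2.
\<close>

section \<open>Finite fields of characteristic 2\<close>

lemma of_nat_card_UNIV_eq_0: "(of_nat CARD('a::{ring_1,finite}) :: 'a) = 0"
proof -
  \<comment> \<open>Translation by 1 permutes the ring, so the sum of all elements does not change,
    although each summand grows by 1.\<close>
  have "(\<Sum>x\<in>(UNIV::'a set). x) = (\<Sum>x\<in>UNIV. x + 1)"
    by (rule sum.reindex_bij_witness[of _ "\<lambda>x. x + 1" "\<lambda>x. x - 1"]) auto
  also have "\<dots> = (\<Sum>x\<in>UNIV. x) + of_nat CARD('a)"
    by (simp add: sum.distrib)
  finally show ?thesis by simp
qed

lemma two_eq_0_if_card_power_2:
  assumes "CARD('a::{field,finite}) = 2 ^ r"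
  shows "(2 :: 'a) = 0"
  using of_nat_card_UNIV_eq_0[where 'a='a] assms by simp

lemma power2_eq_iff_char_2:
  fixes x y :: "'a::field"
  assumes "(2 :: 'a) = 0"
  shows "x\<^sup>2 = y\<^sup>2 \<longleftrightarrow> x = y"
proof
  assume "x\<^sup>2 = y\<^sup>2"
  moreover have "(x - y)\<^sup>2 = x\<^sup>2 - y\<^sup>2 - 2 * (x * y - y\<^sup>2)"
    by (simp add: power2_eq_square algebra_simps)
  ultimately have "(x - y)\<^sup>2 = 0" using assms by simp
  then show "x = y" by simp
qed simp

text \<open>Squaring is injective, hence surjective on a finite field. The root later rescales two
  matrix factors to determinant 1.\<close>

lemma obtain_sqrt_char_2:
  fixes a :: "'a::{field,finite}"
  assumes "(2 :: 'a) = 0"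
  obtains s where "s\<^sup>2 = a"
proof -
  have "inj (\<lambda>x::'a. x\<^sup>2)" by (simp add: inj_on_def power2_eq_iff_char_2[OF assms])
  then have "surj (\<lambda>x::'a. x\<^sup>2)" by (simp add: finite_UNIV_inj_surj)
  then show ?thesis using that by (metis surjD)
qed

lemma neg_eq_self_char_2:
  fixes x :: "'a::field"
  assumes "(2 :: 'a) = 0"
  shows "- x = x"
proof -
  have "x + x = 0" using assms by (simp flip: mult_2)
  then show ?thesis by (rule minus_unique)
qed

section \<open>Character sums\<close>

lemma additive_character_0:
  assumes "additive_character \<psi>" shows "\<psi> 0 = 1"
proof -
  have "\<psi> 0 * \<psi> 0 = \<psi> 0 * 1" "\<psi> 0 \<noteq> 0"
    using assms unfolding additive_character_def by (metis add_0 mult_1_right)+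
  then show ?thesis by (metis mult_left_cancel)
qed

text \<open>Orthogonality: for \<open>t \<noteq> 0\<close> the shift of \<open>s\<close> by
  \<open>x / t\<close> multiplies the sum by \<open>\<psi> x\<close>, which can be chosen different
  from 1.\<close>

lemma sum_nontrivial_additive_character:
  fixes \<psi> :: "'a::{field,finite} \<Rightarrow> complex"
  assumes "nontrivial_additive_character \<psi>"
  shows "(\<Sum>s\<in>UNIV. \<psi> (t * s)) = (if t = 0 then of_nat CARD('a) else 0)"
proof (cases "t = 0")
  case True
  then show ?thesis
    using assms by (simp add: nontrivial_additive_character_def additive_character_0)
next
  case False
  obtain x where x: "\<psi> x \<noteq> 1"
    using assms by (auto simp: nontrivial_additive_character_def)
  have "(\<Sum>s\<in>UNIV. \<psi> (t * s)) = (\<Sum>s\<in>UNIV. \<psi> (t * s + x))"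
    by (rule sum.reindex_bij_witness[of _ "\<lambda>s. s + x / t" "\<lambda>s. s - x / t"])
      (use False in \<open>auto simp: field_simps\<close>)
  also have "\<dots> = (\<Sum>s\<in>UNIV. \<psi> (t * s)) * \<psi> x"
    using assms
    by (simp add: nontrivial_additive_character_def additive_character_def sum_distrib_right)
  finally show ?thesis using x False by simp
qed

lemma sum_prod_kloosterman_char_2:
  fixes \<psi> :: "'a::{field,finite} \<Rightarrow> complex"
  assumes two: "(2 :: 'a) = 0" and psi: "additive_character \<psi>"
  shows "(\<Sum>x\<in>UNIV - {0}. \<Sum>y\<in>UNIV - {0}. \<psi> ((x + inverse x) * (y + inverse y)))
    = (kloosterman_sum \<psi> 1)\<^sup>2"
proof -
  let ?N = "UNIV - {0 :: 'a}"
  have inj: "inj_on (\<lambda>(x, y). (x * y, x / y)) (?N \<times> ?N)"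
  proof (rule inj_onI)
    fix p p' assume mem: "p \<in> ?N \<times> ?N" "p' \<in> ?N \<times> ?N"
      and eq: "(\<lambda>(x, y). (x * y, x / y)) p = (\<lambda>(x, y). (x * y, x / y)) p'"
    obtain x y x' y' where p: "p = (x, y)" "p' = (x', y')" by (metis surj_pair)
    have nz: "x \<noteq> 0" "y \<noteq> 0" "x' \<noteq> 0" "y' \<noteq> 0" using mem p by auto
    have e: "x * y = x' * y'" "x / y = x' / y'" using eq p by auto
    \<comment> \<open>The product of the two coordinates is a square, which determines its root in
      characteristic 2; in odd characteristic the map would be two-to-one.\<close>
    have "(x * y) * (x / y) = (x' * y') * (x' / y')" by (simp only: e)
    then have "x\<^sup>2 = x'\<^sup>2" using nz by (simp add: power2_eq_square)
    then have "x = x'" by (simp only: power2_eq_iff_char_2[OF two])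
    then show "p = p'" using e(1) nz p by simp
  qed
  moreover have "(\<lambda>(x, y). (x * y, x / y)) ` (?N \<times> ?N) \<subseteq> ?N \<times> ?N"
    by auto
  ultimately have bij: "bij_betw (\<lambda>(x, y). (x * y, x / y)) (?N \<times> ?N) (?N \<times> ?N)"
    by (simp add: bij_betw_def endo_inj_surj)
  have "(\<Sum>x\<in>?N. \<Sum>y\<in>?N. \<psi> ((x + inverse x) * (y + inverse y)))
    = (\<Sum>(x, y)\<in>?N \<times> ?N. \<psi> ((x + inverse x) * (y + inverse y)))"
    by (simp add: sum.cartesian_product)
  also have "\<dots> = (\<Sum>p\<in>?N \<times> ?N. (\<lambda>(u, v). \<psi> (u + inverse u) * \<psi> (v + inverse v))
      ((\<lambda>(x, y). (x * y, x / y)) p))"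
  proof (rule sum.cong[OF refl])
    fix p assume p: "p \<in> ?N \<times> ?N"
    obtain x y where xy: "p = (x, y)" by fastforce
    have "(x + inverse x) * (y + inverse y)
      = (x * y + inverse (x * y)) + (x / y + inverse (x / y))"
      using p xy by (simp add: field_simps)
    then show "(case p of (x, y) \<Rightarrow> \<psi> ((x + inverse x) * (y + inverse y)))
      = (\<lambda>(u, v). \<psi> (u + inverse u) * \<psi> (v + inverse v)) ((\<lambda>(x, y). (x * y, x / y)) p)"
      using psi by (simp add: additive_character_def xy del: inverse_mult_distrib inverse_divide)
  qed
  also have "\<dots> = (\<Sum>(u, v)\<in>?N \<times> ?N. \<psi> (u + inverse u) * \<psi> (v + inverse v))"
    by (rule sum.reindex_bij_betw[OF bij])
  also have "\<dots> = (kloosterman_sum \<psi> 1)\<^sup>2"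
    by (simp add: kloosterman_sum_def power2_eq_square sum_product sum.cartesian_product)
  finally show ?thesis .
qed

section \<open>Summing a function of the trace over the special linear group\<close>

definition mat2 :: "'a \<Rightarrow> 'a \<Rightarrow> 'a \<Rightarrow> 'a \<Rightarrow> 'a::zero ^ 2 ^ 2" where
  "mat2 a b c d = vector [vector [a, b], vector [c, d]]"

lemma mat2_nth [simp]:
  "mat2 a b c d $ 1 $ 1 = a" "mat2 a b c d $ 1 $ 2 = b"
  "mat2 a b c d $ 2 $ 1 = c" "mat2 a b c d $ 2 $ 2 = d"
  by (simp_all add: mat2_def)

lemma mat2_eqI:
  "X $ 1 $ 1 = Y $ 1 $ 1 \<Longrightarrow> X $ 1 $ 2 = Y $ 1 $ 2 \<Longrightarrow> X $ 2 $ 1 = Y $ 2 $ 1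
    \<Longrightarrow> X $ 2 $ 2 = Y $ 2 $ 2 \<Longrightarrow> (X :: 'a ^ 2 ^ 2) = Y"
  by (simp add: vec_eq_iff forall_2)

lemma mat2_nth_eq: "mat2 (X $ 1 $ 1) (X $ 1 $ 2) (X $ 2 $ 1) (X $ 2 $ 2) = X"
  by (rule mat2_eqI) simp_all

lemma matrix_mult_2_nth:
  "((X :: 'a::semiring_1 ^ 2 ^ 2) ** Y) $ i $ j = X $ i $ 1 * Y $ 1 $ j + X $ i $ 2 * Y $ 2 $ j"
  by (simp add: matrix_matrix_mult_def sum_2)

lemma transpose_mat2: "transpose (mat2 a b c d) = mat2 a c b d"
  by (rule mat2_eqI) (simp_all add: transpose_def)

lemma trace_2: "trace (X :: 'a::comm_semiring_1 ^ 2 ^ 2) = X $ 1 $ 1 + X $ 2 $ 2"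
  by (simp add: trace_def sum_2)

definition SL2 :: "('a::field ^ 2 ^ 2) set" where
  "SL2 = {g. det g = 1}"

text \<open>For nonzero \<open>m\<close> the entry \<open>b\<close> is any unit and determines
  \<open>c\<close>; for \<open>m = 0\<close> the solutions form the two coordinate axes. The count
  is written as a constant plus a correction at \<open>m = 0\<close>, so that a sum weighted by it
  splits in two.\<close>

lemma card_mult_eq:
  fixes m :: "'a::{field,finite}"
  shows "card {(b, c). b * c = m} = (CARD('a) - 1) + (if m = 0 then CARD('a) else 0)"
proof (cases "m = 0")
  case True
  have "{(b, c). b * c = m} = ({0} \<times> UNIV) \<union> ((UNIV - {0}) \<times> {0 :: 'a})"
    using True by auto
  moreover have "({0 :: 'a} \<times> (UNIV :: 'a set)) \<inter> ((UNIV - {0}) \<times> {0}) = {}" by auto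
  ultimately have "card {(b, c). b * c = m}
    = card ({0 :: 'a} \<times> (UNIV :: 'a set)) + card ((UNIV - {0 :: 'a}) \<times> {0 :: 'a})"
    by (simp only: card_Un_disjoint[OF finite finite])
  then show ?thesis using True by (simp add: card_Diff_singleton)
next
  case False
  have "bij_betw (\<lambda>b. (b, m / b)) (UNIV - {0}) {(b, c). b * c = m}"
    by (rule bij_betw_byWitness[where f' = fst]) (use False in \<open>auto simp: field_simps\<close>)
  then show ?thesis using False
    by (simp add: bij_betw_same_card[symmetric] card_Diff_singleton)
qed

text \<open>Fix the diagonal \<open>(a, d)\<close> and count the off-diagonal pairs with product
  \<open>a * d - 1\<close>. The constant part \<open>q - 1\<close> of the count meets every trace
  value \<open>q\<close> times; the correction \<open>q\<close> survives only for
  \<open>d = inverse a\<close>.\<close>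

lemma sum_SL2_trace:
  fixes F :: "'a::{field,finite} \<Rightarrow> complex"
  defines "q \<equiv> of_nat CARD('a) :: complex"
  shows "(\<Sum>g\<in>SL2. F (trace g)) = (q\<^sup>2 - q) * (\<Sum>t\<in>UNIV. F t)
    + q * (\<Sum>x\<in>UNIV - {0}. F (x + inverse x))"
proof -
  let ?S = "\<lambda>(a::'a, d). {(b, c). b * c = a * d - 1}"
  \<comment> \<open>Justifies casting the natural-number difference \<open>CARD('a) - 1\<close> to
    the complex numbers.\<close>
  have c1: "CARD('a) \<ge> 1" using zero_less_card_finite[where 'a='a] by linarith
  have "(\<Sum>g\<in>SL2. F (trace g)) = (\<Sum>((a, d), (b, c))\<in>Sigma UNIV ?S. F (a + d))"
    by (rule sum.reindex_bij_witness[of _ "\<lambda>((a, d), (b, c)). mat2 a b c d"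
          "\<lambda>g. ((g $ 1 $ 1, g $ 2 $ 2), (g $ 1 $ 2, g $ 2 $ 1))"])
      (auto simp: SL2_def det_2 trace_2 mat2_nth_eq algebra_simps)
  also have "\<dots> = (\<Sum>p\<in>UNIV. \<Sum>bc\<in>?S p. F (fst p + snd p))"
    by (subst sum.Sigma) (auto simp: case_prod_unfold)
  also have "\<dots> = (\<Sum>p\<in>UNIV. F (fst p + snd p) * (q - 1 + (if fst p * snd p = 1 then q else 0)))"
  proof (rule sum.cong[OF refl])
    fix p :: "'a \<times> 'a"
    have "?S p = {(b, c). b * c = fst p * snd p - 1}" by (auto simp: case_prod_unfold)
    then have "card (?S p) = (CARD('a) - 1) + (if fst p * snd p = 1 then CARD('a) else 0)"
      using card_mult_eq[of "fst p * snd p - 1"] by simp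
    then have "of_nat (card (?S p)) = q - 1 + (if fst p * snd p = 1 then q else 0)"
      by (simp only: of_nat_add of_nat_diff[OF c1] q_def) simp
    then show "(\<Sum>bc\<in>?S p. F (fst p + snd p))
      = F (fst p + snd p) * (q - 1 + (if fst p * snd p = 1 then q else 0))"
      by (simp only: sum_constant mult.commute)
  qed
  also have "\<dots> = (\<Sum>a\<in>UNIV. \<Sum>d\<in>UNIV. F (a + d) * (q - 1 + (if a * d = 1 then q else 0)))"
    by (simp add: sum.cartesian_product case_prod_unfold)
  also have "\<dots> = (\<Sum>a\<in>UNIV. (q - 1) * (\<Sum>t\<in>UNIV. F t) + (if a = 0 then 0 else q * F (a + inverse a)))"
  proof (rule sum.cong[OF refl])
    fix a :: 'a
    have "(\<Sum>d\<in>UNIV. F (a + d) * (q - 1 + (if a * d = 1 then q else 0)))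
      = (q - 1) * (\<Sum>d\<in>UNIV. F (a + d)) + (\<Sum>d\<in>UNIV. if a * d = 1 then q * F (a + d) else 0)"
      unfolding sum_distrib_left sum.distrib[symmetric]
      by (rule sum.cong) (auto simp: algebra_simps)
    moreover have "(\<Sum>d\<in>UNIV. F (a + d)) = (\<Sum>t\<in>UNIV. F t)"
      by (rule sum.reindex_bij_witness[of _ "\<lambda>x. x - a" "\<lambda>x. a + x"]) auto
    moreover have "(\<Sum>d\<in>UNIV. if a * d = 1 then q * F (a + d) else 0)
      = (if a = 0 then 0 else q * F (a + inverse a))"
    proof (cases "a = 0")
      case False
      then have "\<And>d. a * d = 1 \<longleftrightarrow> d = inverse a" by (auto simp: field_simps)
      then show ?thesis using False by simp
    qed simp
    ultimately show "(\<Sum>d\<in>UNIV. F (a + d) * (q - 1 + (if a * d = 1 then q else 0)))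
      = (q - 1) * (\<Sum>t\<in>UNIV. F t) + (if a = 0 then 0 else q * F (a + inverse a))"
      by simp
  qed
  also have "\<dots> = q * ((q - 1) * (\<Sum>t\<in>UNIV. F t)) + (\<Sum>a\<in>UNIV. if a = 0 then 0 else q * F (a + inverse a))"
    by (simp add: sum.distrib q_def)
  also have "(\<Sum>a\<in>UNIV. if a = 0 then 0 else q * F (a + inverse a)) = q * (\<Sum>x\<in>UNIV - {0}. F (x + inverse x))"
    unfolding sum_distrib_left by (rule sum.mono_neutral_cong_right) auto
  finally show ?thesis by (simp add: power2_eq_square algebra_simps)
qed

text \<open>The trace formula is applied first in \<open>h\<close>, with \<open>t = trace g\<close>
  fixed, and then in \<open>g\<close> to the resulting function of \<open>t\<close>. That function
  is a point mass at \<open>t = 0\<close> plus a multiple of \<open>K t\<close>.\<close>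

lemma sum_SL2_SL2_trace_char_2:
  fixes \<psi> :: "'a::{field,finite} \<Rightarrow> complex"
  defines "q \<equiv> of_nat CARD('a) :: complex"
  assumes two: "(2 :: 'a) = 0" and psi: "nontrivial_additive_character \<psi>"
  shows "(\<Sum>g\<in>SL2. \<Sum>h\<in>SL2. \<psi> (trace g * trace h)) = q\<^sup>2 * ((kloosterman_sum \<psi> 1)\<^sup>2 + q ^ 3 - q)"
proof -
  define K where "K t = (\<Sum>y\<in>UNIV - {0}. \<psi> (t * (y + inverse y)))" for t
  have add: "additive_character \<psi>" using psi by (simp add: nontrivial_additive_character_def)
  have inner: "(\<Sum>h\<in>SL2. \<psi> (t * trace h)) = (q\<^sup>2 - q) * (if t = 0 then q else 0) + q * K t" for t
    using sum_SL2_trace[of "\<lambda>s. \<psi> (t * s)"] sum_nontrivial_additive_character[OF psi, of t]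
    by (simp add: K_def q_def)
  \<comment> \<open>Multiplying by \<open>y\<close> turns the equation into
    \<open>y\<^sup>2 = 1\<close>, whose only root in characteristic 2 is 1.\<close>
  have inv: "y + inverse y = 0 \<longleftrightarrow> y = 1" if "y \<noteq> 0" for y :: 'a
  proof -
    have "y + inverse y = 0 \<longleftrightarrow> y * (y + inverse y) = 0" using that by simp
    also have "y * (y + inverse y) = y\<^sup>2 + 1"
      using that by (simp add: distrib_left power2_eq_square)
    also have "y\<^sup>2 + 1 = 0 \<longleftrightarrow> y\<^sup>2 = 1\<^sup>2"
      by (simp only: eq_neg_iff_add_eq_0[symmetric] neg_eq_self_char_2[OF two] one_power2)
    finally show ?thesis by (simp only: power2_eq_iff_char_2[OF two])
  qed
  \<comment> \<open>After the exchange of sums, orthogonality in \<open>t\<close> leaves only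
    \<open>y = 1\<close>.\<close>
  have "(\<Sum>t\<in>UNIV. K t) = (\<Sum>y\<in>UNIV - {0}. \<Sum>t\<in>UNIV. \<psi> ((y + inverse y) * t))"
    unfolding K_def by (subst sum.swap) (simp add: mult.commute)
  also have "\<dots> = (\<Sum>y\<in>UNIV - {0 :: 'a}. if y = 1 then q else 0)"
    by (rule sum.cong) (auto simp: sum_nontrivial_additive_character[OF psi] inv q_def)
  also have "\<dots> = q" by simp
  finally have K_UNIV: "(\<Sum>t\<in>UNIV. K t) = q" .
  have K_K: "(\<Sum>x\<in>UNIV - {0}. K (x + inverse x)) = (kloosterman_sum \<psi> 1)\<^sup>2"
    unfolding K_def by (rule sum_prod_kloosterman_char_2[OF two add])
  have "(\<Sum>x\<in>UNIV - {0}. if x + inverse x = (0::'a) then q else 0)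
    = (\<Sum>x\<in>UNIV - {0::'a}. if x = 1 then q else 0)"
    by (rule sum.cong) (auto simp: inv)
  then have one: "(\<Sum>x\<in>UNIV - {0}. if x + inverse x = (0::'a) then q else 0) = q" by simp
  have "(\<Sum>g\<in>SL2. \<Sum>h\<in>SL2. \<psi> (trace g * trace h))
    = (q\<^sup>2 - q) * (\<Sum>t\<in>UNIV. (q\<^sup>2 - q) * (if t = (0::'a) then q else 0) + q * K t)
      + q * (\<Sum>x\<in>UNIV - {0}. (q\<^sup>2 - q) * (if x + inverse x = 0 then q else 0) + q * K (x + inverse x))"
    unfolding inner
    using sum_SL2_trace[of "\<lambda>t. (q\<^sup>2 - q) * (if t = 0 then q else 0) + q * K t"]
    unfolding q_def[symmetric] .
  also have "\<dots> = (q\<^sup>2 - q) * ((q\<^sup>2 - q) * q + q * q) + q * ((q\<^sup>2 - q) * q + q * (kloosterman_sum \<psi> 1)\<^sup>2)"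
    unfolding sum.distrib sum_distrib_left[symmetric] K_UNIV K_K one by simp
  finally show ?thesis by (simp add: algebra_simps power2_eq_square power3_eq_cube)
qed

section \<open>Linear maps preserving the determinant of two-by-two matrices\<close>

lemma SL2_inverse:
  assumes "g \<in> SL2"
  obtains g' where "g' \<in> SL2" "g ** g' = mat 1" "g' ** g = mat 1"
proof
  \<comment> \<open>The adjugate, which is the inverse when the determinant is 1.\<close>
  let ?g' = "mat2 (g $ 2 $ 2) (- g $ 1 $ 2) (- g $ 2 $ 1) (g $ 1 $ 1)"
  show "?g' \<in> SL2" using assms by (simp add: SL2_def det_2 mult.commute)
  show "g ** ?g' = mat 1" "?g' ** g = mat 1"
    using assms by (auto intro!: mat2_eqI simp: SL2_def det_2 matrix_mult_2_nth mat_def mult.commute)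
qed

lemma SL2_mult: "g \<in> SL2 \<Longrightarrow> h \<in> SL2 \<Longrightarrow> g ** h \<in> SL2"
  by (simp add: SL2_def det_mul)

text \<open>A nonzero singular matrix is a column times a row. The column becomes the first column
  of \<open>g\<close>, the row becomes the first row of \<open>h\<close>, and both are completed to
  determinant 1; the cases follow the first nonzero entry.\<close>

lemma rank_one_SL2:
  fixes P :: "'a::field ^ 2 ^ 2"
  assumes "det P = 0" "P \<noteq> 0"
  shows "\<exists>g\<in>SL2. \<exists>h\<in>SL2. P = g ** mat2 1 0 0 0 ** h"
proof -
  obtain a b c d where P: "P = mat2 a b c d" using mat2_nth_eq[of P] by metis
  have d: "a * d = b * c" using assms(1) by (simp add: P det_2)
  have nz: "a \<noteq> 0 \<or> b \<noteq> 0 \<or> c \<noteq> 0 \<or> d \<noteq> 0"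
    using assms(2) by (auto simp: P vec_eq_iff forall_2)
  have *: ?thesis if "g \<in> SL2" "h \<in> SL2" "P = g ** mat2 1 0 0 0 ** h" for g h
    using that by blast
  consider "a \<noteq> 0" | "a = 0" "b \<noteq> 0" | "a = 0" "b = 0" "c \<noteq> 0" | "a = 0" "b = 0" "c = 0"
    by blast
  then show ?thesis
  proof cases
    case 1
    then show ?thesis using d
      by (intro *[of "mat2 1 0 (c / a) 1" "mat2 a b 0 (1 / a)"] mat2_eqI)
        (auto simp: P SL2_def det_2 matrix_mult_2_nth field_simps)
  next
    case 2
    then show ?thesis using d
      by (intro *[of "mat2 1 0 (d / b) 1" "mat2 0 b (- 1 / b) 0"] mat2_eqI)
        (auto simp: P SL2_def det_2 matrix_mult_2_nth field_simps)
  next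
    case 3
    then show ?thesis using d
      by (intro *[of "mat2 0 (- 1 / c) c 0" "mat2 1 (d / c) 0 1"] mat2_eqI)
        (auto simp: P SL2_def det_2 matrix_mult_2_nth field_simps)
  next
    case 4
    then show ?thesis using d nz
      by (intro *[of "mat2 0 (- 1) 1 0" "mat2 0 d (- 1 / d) 0"] mat2_eqI)
        (auto simp: P SL2_def det_2 matrix_mult_2_nth field_simps)
  qed
qed

text \<open>Linearity, expressed through the images of the matrix units because \<open>'a ^ 2 ^ 2\<close> carries no
  scalar multiplication by \<open>'a\<close>.\<close>

definition lin2 :: "('a::field ^ 2 ^ 2 \<Rightarrow> 'a ^ 2 ^ 2) \<Rightarrow> bool" where
  "lin2 W \<longleftrightarrow> (\<forall>X i j. W X $ i $ j =
     X $ 1 $ 1 * W (mat2 1 0 0 0) $ i $ j + X $ 1 $ 2 * W (mat2 0 1 0 0) $ i $ j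
   + X $ 2 $ 1 * W (mat2 0 0 1 0) $ i $ j + X $ 2 $ 2 * W (mat2 0 0 0 1) $ i $ j)"

lemma lin2D:
  assumes "lin2 W"
  shows "W X $ i $ j =
     X $ 1 $ 1 * W (mat2 1 0 0 0) $ i $ j + X $ 1 $ 2 * W (mat2 0 1 0 0) $ i $ j
   + X $ 2 $ 1 * W (mat2 0 0 1 0) $ i $ j + X $ 2 $ 2 * W (mat2 0 0 0 1) $ i $ j"
  using assms unfolding lin2_def by blast

lemma lin2_conjugate:
  assumes "lin2 W"
  shows "lin2 (\<lambda>X. g ** W X ** h)"
  unfolding lin2_def
proof (intro allI)
  fix X i j
  show "(g ** W X ** h) $ i $ j = X $ 1 $ 1 * (g ** W (mat2 1 0 0 0) ** h) $ i $ j +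
    X $ 1 $ 2 * (g ** W (mat2 0 1 0 0) ** h) $ i $ j +
    X $ 2 $ 1 * (g ** W (mat2 0 0 1 0) ** h) $ i $ j +
    X $ 2 $ 2 * (g ** W (mat2 0 0 0 1) ** h) $ i $ j"
    unfolding matrix_mult_2_nth lin2D[OF assms, of X] by (simp add: algebra_simps)
qed

lemma lin2_transpose:
  assumes "lin2 W"
  shows "lin2 (\<lambda>X. W (transpose X))"
  unfolding lin2_def transpose_mat2
  by (subst lin2D[OF assms]) (simp add: transpose_def algebra_simps)

lemma lin2_eqI:
  assumes "lin2 V" "lin2 W" "V (mat2 1 0 0 0) = W (mat2 1 0 0 0)" "V (mat2 0 1 0 0) = W (mat2 0 1 0 0)"
    "V (mat2 0 0 1 0) = W (mat2 0 0 1 0)" "V (mat2 0 0 0 1) = W (mat2 0 0 0 1)"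
  shows "V X = W X"
  unfolding vec_eq_iff lin2D[OF assms(1), of X] lin2D[OF assms(2), of X] by (simp add: assms(3-))

lemma lin2_two_sided_mult: "lin2 (\<lambda>X. g ** X ** h)"
  by (rule lin2_conjugate) (simp add: lin2_def forall_2)

text \<open>The normalized case. The hypothesis on the image of \<open>mat2 0 1 0 0\<close> singles
  out the untransposed kind: a map \<open>g ** transpose X ** h\<close> with \<open>g\<close>,
  \<open>h\<close> in \<open>SL2\<close> that fixes \<open>mat2 1 0 0 0\<close> has a nonzero entry
  there. Comparing coefficients of the determinant then leaves three free entries,
  \<open>Q $ 1 $ 2\<close>, \<open>S $ 1 $ 2\<close> and \<open>S $ 2 $ 1\<close>.\<close>

lemma det_preserving_fixing_E11:
  fixes W :: "'a::{field,finite} ^ 2 ^ 2 \<Rightarrow> 'a ^ 2 ^ 2"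
  assumes two: "(2 :: 'a) = 0" and lin: "lin2 W" and det: "\<And>X. det (W X) = det X"
    and E11: "W (mat2 1 0 0 0) = mat2 1 0 0 0" and E12: "W (mat2 0 1 0 0) $ 2 $ 1 = 0"
  shows "\<exists>g\<in>SL2. \<exists>h\<in>SL2. \<forall>X. W X = g ** X ** h"
proof -
  define Q R S where "Q = W (mat2 0 1 0 0)" and "R = W (mat2 0 0 1 0)" and "S = W (mat2 0 0 0 1)"
  have W: "W X $ i $ j = X $ 1 $ 1 * mat2 1 0 0 0 $ i $ j + X $ 1 $ 2 * Q $ i $ j
    + X $ 2 $ 1 * R $ i $ j + X $ 2 $ 2 * S $ i $ j" for X i j
    using lin2D[OF lin, of X] by (simp add: E11 Q_def R_def S_def)
  \<comment> \<open>An identity of quadratic forms in four variables. Its instances at vectors of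
    zeros and ones isolate the individual coefficients.\<close>
  have D: "(x + y * Q $ 1 $ 1 + z * R $ 1 $ 1 + t * S $ 1 $ 1) * (y * Q $ 2 $ 2 + z * R $ 2 $ 2 + t * S $ 2 $ 2)
    - (y * Q $ 1 $ 2 + z * R $ 1 $ 2 + t * S $ 1 $ 2) * (y * Q $ 2 $ 1 + z * R $ 2 $ 1 + t * S $ 2 $ 1)
    = x * t - y * z" for x y z t
    using det[of "mat2 x y z t"] by (simp add: det_2 W)
  have Q21: "Q $ 2 $ 1 = 0" using E12 by (simp add: Q_def)
  have S22: "S $ 2 $ 2 = 1" using D[of 1 0 0 1] D[of 0 0 0 1] by (simp add: algebra_simps)
  have Q22: "Q $ 2 $ 2 = 0" using D[of 1 1 0 0] D[of 0 1 0 0] by (simp add: algebra_simps)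
  have R22: "R $ 2 $ 2 = 0" using D[of 1 0 1 0] D[of 0 0 1 0] by (simp add: algebra_simps)
  have QR: "Q $ 1 $ 2 * R $ 2 $ 1 = 1"
    using D[of 0 1 1 0] D[of 0 0 1 0] by (auto simp: algebra_simps Q21 Q22 R22)
  have R12: "R $ 1 $ 2 = 0" using D[of 0 0 1 0] QR by (auto simp: R22)
  have S11: "S $ 1 $ 1 = S $ 1 $ 2 * S $ 2 $ 1" using D[of 0 0 0 1] by (simp add: S22)
  have Q11: "Q $ 1 $ 1 = Q $ 1 $ 2 * S $ 2 $ 1"
    using D[of 0 1 0 1] by (simp add: S22 Q22 Q21 S11 algebra_simps)
  have R11: "R $ 1 $ 1 = S $ 1 $ 2 * R $ 2 $ 1"
    using D[of 0 0 1 1] by (simp add: S22 R22 R12 S11 algebra_simps)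
  obtain s where s: "s\<^sup>2 = Q $ 1 $ 2" using obtain_sqrt_char_2[OF two] by metis
  have s0: "s \<noteq> 0" using s QR by auto
  have R21: "R $ 2 $ 1 = 1 / s\<^sup>2" using QR s0 unfolding s[symmetric] by (simp add: field_simps)
  \<comment> \<open>Fixing \<open>mat2 1 0 0 0\<close> forces the first column of \<open>?g\<close>
    and the first row of \<open>?h\<close> up to reciprocal scalars, and determinant 1 gives the
    diagonals. The image \<open>Q\<close> is \<open>s\<close> times the first unit column times the
    second row of \<open>?h\<close>, so \<open>s\<^sup>2\<close> must be \<open>Q $ 1 $ 2\<close>;
    \<open>S\<close> yields the remaining two entries.\<close>
  let ?g = "mat2 s (S $ 1 $ 2 / s) 0 (1 / s)" and ?h = "mat2 (1 / s) 0 (s * S $ 2 $ 1) s"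
  have SL: "?g \<in> SL2" "?h \<in> SL2" using s0 by (auto simp: SL2_def det_2)
  have "W X = ?g ** X ** ?h" for X
    by (rule lin2_eqI[OF lin lin2_two_sided_mult]; rule mat2_eqI)
      (use s0 in \<open>simp_all add: E11 flip: Q_def R_def S_def s,
        simp_all add: matrix_mult_2_nth S22 Q22 Q21 R22 R12 S11 Q11 R11 R21 field_simps
          power2_eq_square flip: s\<close>)
  with SL show ?thesis by blast
qed

text \<open>The image of \<open>mat2 1 0 0 0\<close> is nonzero and singular, so two factors from
  \<open>SL2\<close> move it back to \<open>mat2 1 0 0 0\<close>. The normalized map, or its
  composition with transposition, then satisfies the hypotheses of
  \<open>det_preserving_fixing_E11\<close>.\<close>

lemma det_preserving_classification:
  fixes W :: "'a::{field,finite} ^ 2 ^ 2 \<Rightarrow> 'a ^ 2 ^ 2"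
  assumes two: "(2 :: 'a) = 0" and lin: "lin2 W" and det: "\<And>X. det (W X) = det X"
  shows "\<exists>g\<in>SL2. \<exists>h\<in>SL2. (\<forall>X. W X = g ** X ** h) \<or> (\<forall>X. W X = g ** transpose X ** h)"
proof -
  have det0: "det (W (mat2 1 0 0 0)) = 0" unfolding det by (simp add: det_2)
  have "W (mat2 1 0 0 0) \<noteq> 0"
  proof
    assume "W (mat2 1 0 0 0) = 0"
    \<comment> \<open>Otherwise two matrices of determinants 1 and 0 would have the same
      image.\<close>
    then have "W (mat2 1 0 0 1) = W (mat2 0 0 0 1)"
      unfolding vec_eq_iff by (subst lin2D[OF lin]) simp
    then have "det (mat2 1 0 0 1 :: 'a ^ 2 ^ 2) = det (mat2 0 0 0 1 :: 'a ^ 2 ^ 2)"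
      by (metis det)
    then show False by (simp add: det_2)
  qed
  then obtain g h where g: "g \<in> SL2" and h: "h \<in> SL2"
    and gh: "W (mat2 1 0 0 0) = g ** mat2 1 0 0 0 ** h"
    using rank_one_SL2[OF det0] by blast
  obtain g' where g': "g' \<in> SL2" "g ** g' = mat 1" "g' ** g = mat 1" using SL2_inverse[OF g] .
  obtain h' where h': "h' \<in> SL2" "h ** h' = mat 1" "h' ** h = mat 1" using SL2_inverse[OF h] .
  define V where "V X = g' ** W X ** h'" for X
  have V_E11: "V (mat2 1 0 0 0) = mat2 1 0 0 0"
    unfolding V_def gh by (metis g' h' matrix_mul_assoc matrix_mul_lid matrix_mul_rid)
  have W_V: "W X = g ** V X ** h" for X
    unfolding V_def by (metis g' h' matrix_mul_assoc matrix_mul_lid matrix_mul_rid)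
  have linV: "lin2 V" using lin2_conjugate[OF lin, of g' h'] by (simp add: V_def[abs_def])
  have detV: "det (V X) = det X" for X
    using g'(1) h'(1) by (simp add: V_def det_mul det SL2_def)
  \<comment> \<open>Both images have off-diagonal product 0. If both lower left entries were
    nonzero, both upper right entries would vanish, against the determinant of the image of the
    sum.\<close>
  have V21: "V (mat2 0 1 0 0) $ 2 $ 1 = 0 \<or> V (mat2 0 0 1 0) $ 2 $ 1 = 0"
  proof -
    define Q R where "Q = V (mat2 0 1 0 0)" and "R = V (mat2 0 0 1 0)"
    have V: "V (mat2 x y z 0) $ i $ j = x * mat2 1 0 0 0 $ i $ j + y * Q $ i $ j + z * R $ i $ j"
      for x y z i j
      using lin2D[OF linV, of "mat2 x y z 0"] by (simp add: V_E11 Q_def R_def)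
    have D: "(x + y * Q $ 1 $ 1 + z * R $ 1 $ 1) * (y * Q $ 2 $ 2 + z * R $ 2 $ 2)
      - (y * Q $ 1 $ 2 + z * R $ 1 $ 2) * (y * Q $ 2 $ 1 + z * R $ 2 $ 1) = - (y * z)" for x y z
      using detV[of "mat2 x y z 0"] by (simp add: det_2 V)
    have 1: "Q $ 2 $ 2 = 0" using D[of 1 1 0] D[of 0 1 0] by (simp add: algebra_simps)
    have 2: "R $ 2 $ 2 = 0" using D[of 1 0 1] D[of 0 0 1] by (simp add: algebra_simps)
    have 3: "Q $ 1 $ 2 * Q $ 2 $ 1 = 0" using D[of 0 1 0] by (simp add: 1)
    have 4: "R $ 1 $ 2 * R $ 2 $ 1 = 0" using D[of 0 0 1] by (simp add: 2)
    have 5: "(Q $ 1 $ 2 + R $ 1 $ 2) * (Q $ 2 $ 1 + R $ 2 $ 1) = 1"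
      using D[of 0 1 1] by (simp add: 1 2)
    show ?thesis using 3 4 5 by (auto simp flip: Q_def R_def)
  qed
  have "\<exists>g\<in>SL2. \<exists>h\<in>SL2. (\<forall>X. V X = g ** X ** h) \<or> (\<forall>X. V X = g ** transpose X ** h)"
    using V21
  proof
    assume "V (mat2 0 1 0 0) $ 2 $ 1 = 0"
    from det_preserving_fixing_E11[OF two linV detV V_E11 this] show ?thesis by blast
  next
    assume "V (mat2 0 0 1 0) $ 2 $ 1 = 0"
    then have "\<exists>g\<in>SL2. \<exists>h\<in>SL2. \<forall>X. V (transpose X) = g ** X ** h"
      by (intro det_preserving_fixing_E11[OF two lin2_transpose[OF linV]])
        (simp_all add: detV det_transpose transpose_mat2 V_E11)
    then show ?thesis by (metis transpose_transpose)
  qed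
  then obtain a b where ab: "a \<in> SL2" "b \<in> SL2"
    and *: "(\<forall>X. V X = a ** X ** b) \<or> (\<forall>X. V X = a ** transpose X ** b)" by blast
  have "(\<forall>X. W X = (g ** a) ** X ** (b ** h)) \<or> (\<forall>X. W X = (g ** a) ** transpose X ** (b ** h))"
    using * by (auto simp: W_V matrix_mul_assoc)
  with SL2_mult[OF g ab(1)] SL2_mult[OF ab(2) h] show ?thesis by blast
qed

section \<open>The groups of rank one and two\<close>

lemma sum_UNIV_Plus:
  "(\<Sum>i\<in>(UNIV :: ('m::finite + 'n::finite) set). f i) = (\<Sum>i\<in>UNIV. f (Inl i)) + (\<Sum>i\<in>UNIV. f (Inr i))"
  by (simp add: sum.Plus flip: UNIV_Plus_UNIV)

section \<open>Rank two: four-dimensional vectors as two-by-two matrices\<close>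

definition vec_to_mat2 :: "'a::zero ^ (2 + 2) \<Rightarrow> 'a ^ 2 ^ 2" where
  "vec_to_mat2 x = mat2 (x $ Inl 1) (x $ Inl 2) (x $ Inr 2) (x $ Inr 1)"

text \<open>The second row is read backwards: the partners \<open>Inl i\<close> and
  \<open>Inr i\<close> then lie on a common diagonal of the matrix, so that the determinant is
  \<open>theta_plus\<close> up to a sign.\<close>

definition mat2_to_vec :: "'a ^ 2 ^ 2 \<Rightarrow> 'a ^ (2 + 2)" where
  "mat2_to_vec X = (\<chi> i. case i of Inl j \<Rightarrow> X $ 1 $ j | Inr j \<Rightarrow> X $ 2 $ (if j = 1 then 2 else 1))"

lemma mat2_to_vec_nth [simp]:
  "mat2_to_vec X $ Inl j = X $ 1 $ j" "mat2_to_vec X $ Inr 1 = X $ 2 $ 2" "mat2_to_vec X $ Inr 2 = X $ 2 $ 1"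
  by (simp_all add: mat2_to_vec_def)

lemma vec_2_2_eqI:
  "x $ Inl 1 = y $ Inl 1 \<Longrightarrow> x $ Inl 2 = y $ Inl 2 \<Longrightarrow> x $ Inr 1 = y $ Inr 1 \<Longrightarrow> x $ Inr 2 = y $ Inr 2
    \<Longrightarrow> (x :: 'a ^ (2 + 2)) = y"
  by (simp add: vec_eq_iff split_sum_all forall_2)

lemma mat2_to_vec_vec_to_mat2: "mat2_to_vec (vec_to_mat2 x) = x"
  by (rule vec_2_2_eqI) (simp_all add: vec_to_mat2_def)

lemma vec_to_mat2_mat2_to_vec: "vec_to_mat2 (mat2_to_vec X) = X"
  by (simp add: vec_to_mat2_def mat2_nth_eq)

lemma vec_to_mat2_axis:
  "vec_to_mat2 (axis (Inl 1) (1 :: 'a::zero_neq_one)) = mat2 1 0 0 0"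
  "vec_to_mat2 (axis (Inl 2) (1 :: 'a)) = mat2 0 1 0 0"
  "vec_to_mat2 (axis (Inr 1) (1 :: 'a)) = mat2 0 0 0 1"
  "vec_to_mat2 (axis (Inr 2) (1 :: 'a)) = mat2 0 0 1 0"
  by (simp_all add: vec_to_mat2_def axis_def)

lemma theta_plus_eq_det_char_2:
  fixes x :: "'a::field ^ (2 + 2)"
  assumes "(2 :: 'a) = 0"
  shows "theta_plus x = det (vec_to_mat2 x)"
proof -
  have "det (vec_to_mat2 x) = x $ Inl 1 * x $ Inr 1 + - (x $ Inl 2 * x $ Inr 2)"
    by (simp add: vec_to_mat2_def det_2)
  then show ?thesis
    unfolding neg_eq_self_char_2[OF assms] by (simp add: theta_plus_def sum_2)
qed

definition matrix_of_mat2_map :: "('a::field ^ 2 ^ 2 \<Rightarrow> 'a ^ 2 ^ 2) \<Rightarrow> 'a ^ (2 + 2) ^ (2 + 2)" where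
  "matrix_of_mat2_map W = matrix (\<lambda>x. mat2_to_vec (W (vec_to_mat2 x)))"

lemma matrix_of_mat2_map_nth:
  "matrix_of_mat2_map W $ i $ j = mat2_to_vec (W (vec_to_mat2 (axis j 1))) $ i"
  by (simp add: matrix_of_mat2_map_def matrix_def)

lemma matrix_of_mat2_map_mult:
  assumes "lin2 W"
  shows "matrix_of_mat2_map W *v x = mat2_to_vec (W (vec_to_mat2 x))"
proof -
  have *: "(matrix_of_mat2_map W *v x) $ i = x $ Inl 1 * mat2_to_vec (W (mat2 1 0 0 0)) $ i
    + x $ Inl 2 * mat2_to_vec (W (mat2 0 1 0 0)) $ i + x $ Inr 1 * mat2_to_vec (W (mat2 0 0 0 1)) $ i
    + x $ Inr 2 * mat2_to_vec (W (mat2 0 0 1 0)) $ i" for i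
    by (simp add: matrix_vector_mult_def sum_UNIV_Plus sum_2 matrix_of_mat2_map_nth
        vec_to_mat2_axis mult.commute)
  show ?thesis
    by (rule vec_2_2_eqI; unfold * mat2_to_vec_nth; subst lin2D[OF assms, of "vec_to_mat2 x"])
      (simp_all add: vec_to_mat2_def algebra_simps)
qed

lemma O_plus_2_classification:
  fixes w :: "'a::{field,finite} ^ (2 + 2) ^ (2 + 2)"
  assumes two: "(2 :: 'a) = 0" and w: "w \<in> O_plus"
  shows "\<exists>g\<in>SL2. \<exists>h\<in>SL2. w = matrix_of_mat2_map (\<lambda>X. g ** X ** h)
    \<or> w = matrix_of_mat2_map (\<lambda>X. g ** transpose X ** h)"
proof -
  define W where "W X = vec_to_mat2 (w *v mat2_to_vec X)" for X
  have lin: "lin2 W"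
    unfolding lin2_def
  proof (intro allI)
    fix X :: "'a ^ 2 ^ 2" and i j
    have "mat2_to_vec X = X $ 1 $ 1 *s mat2_to_vec (mat2 1 0 0 0) + X $ 1 $ 2 *s mat2_to_vec (mat2 0 1 0 0)
      + X $ 2 $ 1 *s mat2_to_vec (mat2 0 0 1 0) + X $ 2 $ 2 *s mat2_to_vec (mat2 0 0 0 1)"
      by (rule vec_2_2_eqI) simp_all
    then have wX: "w *v mat2_to_vec X = X $ 1 $ 1 *s (w *v mat2_to_vec (mat2 1 0 0 0))
      + X $ 1 $ 2 *s (w *v mat2_to_vec (mat2 0 1 0 0)) + X $ 2 $ 1 *s (w *v mat2_to_vec (mat2 0 0 1 0))
      + X $ 2 $ 2 *s (w *v mat2_to_vec (mat2 0 0 0 1))"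
      by (simp add: matrix_vector_right_distrib vector_scalar_commute)
    have "vec_to_mat2 (a *s x + b *s y + c *s z + d *s t) $ i $ j = a * vec_to_mat2 x $ i $ j
      + b * vec_to_mat2 y $ i $ j + c * vec_to_mat2 z $ i $ j + d * vec_to_mat2 t $ i $ j"
      for a b c d :: 'a and x y z t
      using exhaust_2[of i] exhaust_2[of j] by (auto simp: vec_to_mat2_def)
    then show "W X $ i $ j = X $ 1 $ 1 * W (mat2 1 0 0 0) $ i $ j + X $ 1 $ 2 * W (mat2 0 1 0 0) $ i $ j
      + X $ 2 $ 1 * W (mat2 0 0 1 0) $ i $ j + X $ 2 $ 2 * W (mat2 0 0 0 1) $ i $ j"
      unfolding W_def wX .
  qed
  have "det (W X) = det X" for X
    using w theta_plus_eq_det_char_2[OF two, of "w *v mat2_to_vec X"]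
      theta_plus_eq_det_char_2[OF two, of "mat2_to_vec X"]
    by (simp add: W_def O_plus_def vec_to_mat2_mat2_to_vec)
  from det_preserving_classification[OF two lin this]
  obtain g h where gh: "g \<in> SL2" "h \<in> SL2"
    "(\<forall>X. W X = g ** X ** h) \<or> (\<forall>X. W X = g ** transpose X ** h)" by blast
  have "w = matrix_of_mat2_map W"
    by (simp add: matrix_eq matrix_of_mat2_map_mult[OF lin] W_def mat2_to_vec_vec_to_mat2)
  moreover have "W = (\<lambda>X. g ** X ** h) \<or> W = (\<lambda>X. g ** transpose X ** h)"
    using gh(3) by auto
  ultimately show ?thesis using gh(1,2) by blast
qed

lemma matrix_of_mat2_map_in_O_plus:
  fixes g h :: "'a::{field,finite} ^ 2 ^ 2"
  assumes two: "(2 :: 'a) = 0" and g: "g \<in> SL2" and h: "h \<in> SL2"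
  shows "matrix_of_mat2_map (\<lambda>X. g ** X ** h) \<in> O_plus"
proof -
  let ?w = "matrix_of_mat2_map (\<lambda>X. g ** X ** h)"
  note w = matrix_of_mat2_map_mult[OF lin2_two_sided_mult]
  obtain g' where g': "g' ** g = mat 1" using SL2_inverse[OF g] by metis
  obtain h' where h': "h ** h' = mat 1" using SL2_inverse[OF h] by metis
  have inv: "g' ** (g ** X ** h) ** h' = X" for X
    by (metis g' h' matrix_mul_assoc matrix_mul_lid matrix_mul_rid)
  have "matrix_of_mat2_map (\<lambda>X. g' ** X ** h') ** ?w = mat 1"
    unfolding matrix_eq
    by (simp add: w mat2_to_vec_vec_to_mat2 vec_to_mat2_mat2_to_vec inv flip: matrix_vector_mul_assoc)
  then have "invertible ?w" by (auto simp: invertible_left_inverse)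
  moreover have "theta_plus (?w *v x) = theta_plus x" for x
    using g h by (simp add: theta_plus_eq_det_char_2[OF two] w vec_to_mat2_mat2_to_vec det_mul SL2_def)
  ultimately show ?thesis by (simp add: O_plus_def)
qed

lemma delta_plus_2:
  fixes w :: "'a::field ^ (2 + 2) ^ (2 + 2)"
  shows "delta_plus w = w $ Inl 1 $ Inr 1 * w $ Inr 1 $ Inl 1 + w $ Inl 1 $ Inr 2 * w $ Inr 1 $ Inl 2
    + w $ Inl 2 $ Inr 1 * w $ Inr 2 $ Inl 1 + w $ Inl 2 $ Inr 2 * w $ Inr 2 $ Inl 2"
  by (simp add: delta_plus_def trace_2 matrix_mult_2_nth block_B_def block_C_def transpose_def)

text \<open>Each of the four products in \<open>delta_plus_2\<close> contains
  \<open>g $ 1 $ 2 * g $ 2 $ 1\<close>, and their cofactors in \<open>h\<close> agree in pairs, so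
  the sum is even.\<close>

lemma delta_plus_two_sided_mult:
  fixes g h :: "'a::field ^ 2 ^ 2"
  assumes "(2 :: 'a) = 0"
  shows "delta_plus (matrix_of_mat2_map (\<lambda>X. g ** X ** h)) = 0"
proof -
  have "delta_plus (matrix_of_mat2_map (\<lambda>X. g ** X ** h))
    = 2 * (g $ 1 $ 2 * g $ 2 $ 1 * (h $ 1 $ 1 * h $ 2 $ 2 + h $ 1 $ 2 * h $ 2 $ 1))"
    by (simp add: delta_plus_2 matrix_of_mat2_map_nth vec_to_mat2_axis matrix_mult_2_nth algebra_simps)
  then show ?thesis using assms by simp
qed

text \<open>On \<open>SL2\<close> the value is 1, which keeps maps of the transposed kind out of
  \<open>SO_plus\<close>.\<close>

lemma delta_plus_two_sided_mult_transpose: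
  fixes g h :: "'a::field ^ 2 ^ 2"
  assumes "(2 :: 'a) = 0"
  shows "delta_plus (matrix_of_mat2_map (\<lambda>X. g ** transpose X ** h)) = det g * det h"
proof -
  have "delta_plus (matrix_of_mat2_map (\<lambda>X. g ** transpose X ** h))
    = det g * det h + 2 * (g $ 1 $ 1 * g $ 2 $ 2 * h $ 1 $ 2 * h $ 2 $ 1 + g $ 1 $ 2 * g $ 2 $ 1 * h $ 1 $ 1 * h $ 2 $ 2)"
    by (simp add: delta_plus_2 matrix_of_mat2_map_nth vec_to_mat2_axis matrix_mult_2_nth
        transpose_def det_2 algebra_simps)
  then show ?thesis using assms by simp
qed

lemma SO_plus_2_eq_image:
  assumes two: "(2 :: 'a::{field,finite}) = 0"
  shows "(SO_plus :: ('a ^ (2 + 2) ^ (2 + 2)) set)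
    = (\<lambda>(g, h). matrix_of_mat2_map (\<lambda>X. g ** X ** h)) ` (SL2 \<times> SL2)"
proof (intro equalityI subsetI)
  fix w :: "'a ^ (2 + 2) ^ (2 + 2)" assume w: "w \<in> SO_plus"
  then obtain g h where gh: "g \<in> SL2" "h \<in> SL2" "w = matrix_of_mat2_map (\<lambda>X. g ** X ** h)
    \<or> w = matrix_of_mat2_map (\<lambda>X. g ** transpose X ** h)"
    using O_plus_2_classification[OF two] unfolding SO_plus_def by blast
  moreover have "w \<noteq> matrix_of_mat2_map (\<lambda>X. g ** transpose X ** h)"
    using w gh(1,2) delta_plus_two_sided_mult_transpose[OF two, of g h]
    by (auto simp: SO_plus_def SL2_def)
  ultimately show "w \<in> (\<lambda>(g, h). matrix_of_mat2_map (\<lambda>X. g ** X ** h)) ` (SL2 \<times> SL2)"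
    by auto
next
  fix w :: "'a ^ (2 + 2) ^ (2 + 2)"
  assume "w \<in> (\<lambda>(g, h). matrix_of_mat2_map (\<lambda>X. g ** X ** h)) ` (SL2 \<times> SL2)"
  then show "w \<in> SO_plus"
    using matrix_of_mat2_map_in_O_plus[OF two] delta_plus_two_sided_mult[OF two]
    by (auto simp: SO_plus_def)
qed

text \<open>The map determines all products of an entry of \<open>g\<close> with an entry of
  \<open>h\<close>, hence \<open>g\<close> up to a scalar \<open>c\<close>. Determinant 1 gives
  \<open>c\<^sup>2 = 1\<close>, so \<open>c = 1\<close> in characteristic 2.\<close>

lemma inj_on_two_sided_mult:
  assumes two: "(2 :: 'a::field) = 0"
  shows "inj_on (\<lambda>(g :: 'a ^ 2 ^ 2, h). matrix_of_mat2_map (\<lambda>X. g ** X ** h)) (SL2 \<times> SL2)"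
proof (rule inj_onI)
  fix p p' :: "('a ^ 2 ^ 2) \<times> ('a ^ 2 ^ 2)"
  assume mem: "p \<in> SL2 \<times> SL2" "p' \<in> SL2 \<times> SL2"
    and eq: "(case p of (g, h) \<Rightarrow> matrix_of_mat2_map (\<lambda>X. g ** X ** h))
      = (case p' of (g, h) \<Rightarrow> matrix_of_mat2_map (\<lambda>X. g ** X ** h))"
  obtain g h k l where p: "p = (g, h)" "p' = (k, l)" by (metis surj_pair)
  have SL: "det g = 1" "det h = 1" "det k = 1" "det l = 1" using mem p by (auto simp: SL2_def)
  have eq': "g ** X ** h = k ** X ** l" for X
    using eq p matrix_of_mat2_map_mult[OF lin2_two_sided_mult, of g h "mat2_to_vec X"]
      matrix_of_mat2_map_mult[OF lin2_two_sided_mult, of k l "mat2_to_vec X"]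
    by (metis old.prod.case vec_to_mat2_mat2_to_vec)
  have entry: "g $ i $ a * h $ b $ j = k $ i $ a * l $ b $ j" for i a b j
  proof -
    \<comment> \<open>The middle factor is the matrix unit with its 1 in position
      \<open>(a, b)\<close>.\<close>
    have e: "(X ** (mat2 (if a = 1 \<and> b = 1 then 1 else 0) (if a = 1 \<and> b = 2 then 1 else 0)
      (if a = 2 \<and> b = 1 then 1 else 0) (if a = 2 \<and> b = 2 then 1 else 0)) ** Y) $ i $ j = X $ i $ a * Y $ b $ j" for X Y :: "'a ^ 2 ^ 2"
      using exhaust_2[of a] exhaust_2[of b] by (auto simp: matrix_mult_2_nth)
    show ?thesis unfolding e[symmetric] eq' ..
  qed
  obtain b j where bj: "h $ b $ j \<noteq> 0" using SL(2) by (metis det_2 diff_self mult_zero_left zero_neq_one)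
  define c where "c = l $ b $ j / h $ b $ j"
  have gk: "g $ i $ a = c * k $ i $ a" for i a
    using entry[of i a b j] bj by (simp add: c_def field_simps)
  have "det g = c\<^sup>2 * det k" by (simp add: det_2 gk power2_eq_square algebra_simps)
  then have "c\<^sup>2 = 1\<^sup>2" using SL by simp
  then have "c = 1" by (simp only: power2_eq_iff_char_2[OF two])
  then have g: "g = k" using gk by (simp add: vec_eq_iff)
  obtain i a where ia: "k $ i $ a \<noteq> 0" using SL(3) by (metis det_2 diff_self mult_zero_left zero_neq_one)
  have "h = l" using entry[of i a] ia by (simp add: vec_eq_iff g)
  with g p show "p = p'" by simp
qed

text \<open>The map is the tensor product of \<open>g\<close> and the transpose of
  \<open>h\<close>.\<close>

lemma trace_two_sided_mult:
  fixes g h :: "'a::field ^ 2 ^ 2"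
  shows "trace (matrix_of_mat2_map (\<lambda>X. g ** X ** h)) = trace g * trace h"
  by (simp add: trace_def sum_UNIV_Plus sum_2 matrix_of_mat2_map_nth vec_to_mat2_axis
      matrix_mult_2_nth algebra_simps)

lemma sum_SO_plus_2:
  fixes \<psi> :: "'a::{field,finite} \<Rightarrow> complex"
  defines "q \<equiv> of_nat CARD('a) :: complex"
  assumes two: "(2 :: 'a) = 0" and psi: "nontrivial_additive_character \<psi>"
  shows "(\<Sum>w\<in>(SO_plus :: ('a ^ (2 + 2) ^ (2 + 2)) set). \<psi> (trace w))
    = q\<^sup>2 * ((kloosterman_sum \<psi> 1)\<^sup>2 + q ^ 3 - q)"
proof -
  have "(\<Sum>w\<in>(SO_plus :: ('a ^ (2 + 2) ^ (2 + 2)) set). \<psi> (trace w))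
    = (\<Sum>(g, h)\<in>SL2 \<times> SL2. \<psi> (trace g * trace h))"
    unfolding SO_plus_2_eq_image[OF two] sum.reindex[OF inj_on_two_sided_mult[OF two]]
    by (rule sum.cong) (auto simp: trace_two_sided_mult)
  also have "\<dots> = q\<^sup>2 * ((kloosterman_sum \<psi> 1)\<^sup>2 + q ^ 3 - q)"
    using sum_SL2_SL2_trace_char_2[OF two psi] by (simp add: sum.cartesian_product q_def)
  finally show ?thesis .
qed

section \<open>Rank one: diagonal and antidiagonal matrices\<close>

definition mat11 :: "'a \<Rightarrow> 'a \<Rightarrow> 'a \<Rightarrow> 'a \<Rightarrow> 'a ^ (1 + 1) ^ (1 + 1)" where
  "mat11 a b c d = (\<chi> i j. case i of Inl _ \<Rightarrow> (case j of Inl _ \<Rightarrow> a | Inr _ \<Rightarrow> b)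
     | Inr _ \<Rightarrow> (case j of Inl _ \<Rightarrow> c | Inr _ \<Rightarrow> d))"

lemma mat11_nth [simp]:
  "mat11 a b c d $ Inl i $ Inl j = a" "mat11 a b c d $ Inl i $ Inr j = b"
  "mat11 a b c d $ Inr i $ Inl j = c" "mat11 a b c d $ Inr i $ Inr j = d"
  by (simp_all add: mat11_def)

lemma forall_num1_sum: "(\<forall>i :: 1 + 1. P i) \<longleftrightarrow> P (Inl 1) \<and> P (Inr 1)"
  by (simp add: split_sum_all forall_1)

lemma mat11_cases: obtains a b c d where "w = mat11 a b c d"
proof
  show "w = mat11 (w $ Inl 1 $ Inl 1) (w $ Inl 1 $ Inr 1) (w $ Inr 1 $ Inl 1) (w $ Inr 1 $ Inr 1)"
    by (simp add: vec_eq_iff forall_num1_sum)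
qed

lemma mat11_eq_iff: "mat11 a b c d = mat11 a' b' c' d' \<longleftrightarrow> a = a' \<and> b = b' \<and> c = c' \<and> d = d'"
  by (auto simp: vec_eq_iff forall_num1_sum)

lemma trace_mat11: "trace (mat11 a b c d) = a + d"
  by (simp add: trace_def sum_UNIV_Plus)

lemma delta_plus_mat11: "delta_plus (mat11 a b c d) = b * c"
  by (simp add: delta_plus_def trace_def block_B_def block_C_def transpose_def matrix_matrix_mult_def)

lemma mat11_mult: "mat11 a b c d ** mat11 a' b' c' d'
  = mat11 (a * a' + b * c') (a * b' + b * d') (c * a' + d * c') (c * b' + d * d')"
  by (simp add: vec_eq_iff forall_num1_sum matrix_matrix_mult_def sum_UNIV_Plus)

lemma mat_1_eq_mat11: "mat 1 = mat11 1 0 0 1"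
  by (simp add: vec_eq_iff forall_num1_sum mat_def)

lemma theta_plus_mat11: "theta_plus (mat11 a b c d *v x)
  = (a * x $ Inl 1 + b * x $ Inr 1) * (c * x $ Inl 1 + d * x $ Inr 1)"
  by (simp add: theta_plus_def matrix_vector_mult_def sum_UNIV_Plus)

lemma mat11_in_O_plus_iff:
  fixes a b c d :: "'a::field"
  shows "mat11 a b c d \<in> O_plus \<longleftrightarrow> (b = 0 \<and> c = 0 \<and> a * d = 1) \<or> (a = 0 \<and> d = 0 \<and> b * c = 1)"
proof
  assume "mat11 a b c d \<in> O_plus"
  then have th: "(a * x $ Inl 1 + b * x $ Inr 1) * (c * x $ Inl 1 + d * x $ Inr 1) = x $ Inl 1 * x $ Inr 1"
    for x :: "'a ^ (1 + 1)"
    by (simp add: O_plus_def theta_plus_mat11) (simp add: theta_plus_def)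
  have th': "(a * s + b * t) * (c * s + d * t) = s * t" for s t
    using th[of "\<chi> i. case i of Inl _ \<Rightarrow> s | Inr _ \<Rightarrow> t"] by simp
  \<comment> \<open>The three instances amount to \<open>a * c = 0\<close>, \<open>b * d = 0\<close>
    and \<open>a * d + b * c = 1\<close>.\<close>
  show "(b = 0 \<and> c = 0 \<and> a * d = 1) \<or> (a = 0 \<and> d = 0 \<and> b * c = 1)"
    using th'[of 1 0] th'[of 0 1] th'[of 1 1] by auto
next
  assume *: "(b = 0 \<and> c = 0 \<and> a * d = 1) \<or> (a = 0 \<and> d = 0 \<and> b * c = 1)"
  \<comment> \<open>One inverse for both cases: a diagonal element has its entries swapped, while an
    antidiagonal element is an involution.\<close>
  have "mat11 d b c a ** mat11 a b c d = mat 1"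
    using * by (auto simp: mat11_mult mat_1_eq_mat11 mat11_eq_iff mult.commute)
  then have "invertible (mat11 a b c d)" by (auto simp: invertible_left_inverse)
  moreover have "theta_plus (mat11 a b c d *v x) = theta_plus x" for x
    unfolding theta_plus_mat11 using * by (auto simp: theta_plus_def algebra_simps)
  ultimately show "mat11 a b c d \<in> O_plus" by (simp add: O_plus_def)
qed

lemma SO_plus_1_eq:
  "(SO_plus :: ('a::field ^ (1 + 1) ^ (1 + 1)) set) = (\<lambda>a. mat11 a 0 0 (inverse a)) ` (UNIV - {0})"
proof (intro equalityI subsetI)
  fix w :: "'a ^ (1 + 1) ^ (1 + 1)" assume w: "w \<in> SO_plus"
  obtain a b c d where abcd: "w = mat11 a b c d" by (rule mat11_cases)
  have "b = 0" "c = 0" "a * d = 1"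
    using w by (auto simp: abcd SO_plus_def mat11_in_O_plus_iff delta_plus_mat11)
  moreover from this have "d = inverse a" by (metis inverse_unique)
  ultimately show "w \<in> (\<lambda>a. mat11 a 0 0 (inverse a)) ` (UNIV - {0})"
    by (intro image_eqI[of _ _ a]) (auto simp: abcd)
qed (auto simp: SO_plus_def mat11_in_O_plus_iff delta_plus_mat11)

lemma O_plus_1_eq:
  "(O_plus :: ('a::field ^ (1 + 1) ^ (1 + 1)) set) = SO_plus \<union> (\<lambda>b. mat11 0 b (inverse b) 0) ` (UNIV - {0})"
proof (intro equalityI subsetI)
  fix w :: "'a ^ (1 + 1) ^ (1 + 1)" assume w: "w \<in> O_plus"
  obtain a b c d where abcd: "w = mat11 a b c d" by (rule mat11_cases)
  show "w \<in> SO_plus \<union> (\<lambda>b. mat11 0 b (inverse b) 0) ` (UNIV - {0})"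
  proof (cases "w \<in> SO_plus")
    case False
    then have "a = 0" "d = 0" "b * c = 1"
      using w by (auto simp: abcd SO_plus_def mat11_in_O_plus_iff delta_plus_mat11)
    moreover from this have "c = inverse b" by (metis inverse_unique)
    ultimately show ?thesis by (intro UnI2 image_eqI[of _ _ b]) (auto simp: abcd)
  qed simp
qed (auto simp: SO_plus_def mat11_in_O_plus_iff, metis right_inverse)

lemma sum_SO_plus_1:
  fixes \<psi> :: "'a::{field,finite} \<Rightarrow> complex"
  shows "(\<Sum>w\<in>(SO_plus :: ('a ^ (1 + 1) ^ (1 + 1)) set). \<psi> (trace w)) = kloosterman_sum \<psi> 1"
proof -
  have "inj_on (\<lambda>a::'a. mat11 a 0 0 (inverse a)) (UNIV - {0})"
    by (auto simp: inj_on_def mat11_eq_iff)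
  then show ?thesis
    by (simp add: SO_plus_1_eq sum.reindex trace_mat11 kloosterman_sum_def)
qed

text \<open>The elements outside \<open>SO_plus\<close> are antidiagonal and have trace 0, so each
  of them contributes \<open>\<psi> 0 = 1\<close>.\<close>

lemma sum_O_plus_1:
  fixes \<psi> :: "'a::{field,finite} \<Rightarrow> complex"
  assumes "additive_character \<psi>"
  shows "(\<Sum>w\<in>(O_plus :: ('a ^ (1 + 1) ^ (1 + 1)) set). \<psi> (trace w))
    = kloosterman_sum \<psi> 1 + of_nat CARD('a) - 1"
proof -
  let ?f = "\<lambda>b::'a. mat11 0 b (inverse b) 0"
  have inj: "inj_on ?f (UNIV - {0})"
    by (auto simp: inj_on_def mat11_eq_iff)
  have "SO_plus \<inter> ?f ` (UNIV - {0}) = {}"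
    by (auto simp: SO_plus_1_eq mat11_eq_iff)
  then have "(\<Sum>w\<in>(O_plus :: ('a ^ (1 + 1) ^ (1 + 1)) set). \<psi> (trace w))
    = kloosterman_sum \<psi> 1 + (\<Sum>w\<in>?f ` (UNIV - {0}). \<psi> (trace w))"
    unfolding O_plus_1_eq by (subst sum.union_disjoint) (simp_all add: sum_SO_plus_1)
  also have "(\<Sum>w\<in>?f ` (UNIV - {0}). \<psi> (trace w)) = of_nat CARD('a) - 1"
    by (simp add: sum.reindex[OF inj] trace_mat11 additive_character_0[OF assms]
        card_Diff_singleton of_nat_diff Suc_leI)
  finally show ?thesis by simp
qed

theorem theorem3:
  fixes \<psi> :: "'a::{field,finite} \<Rightarrow> complex" and q r :: nat
  assumes "q = 2 ^ r" and "CARD('a) = q"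
    and "nontrivial_additive_character \<psi>"
  shows "(\<Sum>w\<in>(SO_plus :: ('a ^ (1 + 1) ^ (1 + 1)) set). \<psi> (trace w))
           = kloosterman_sum \<psi> 1
       \<and> (\<Sum>w\<in>(O_plus :: ('a ^ (1 + 1) ^ (1 + 1)) set). \<psi> (trace w))
           = kloosterman_sum \<psi> 1 + of_nat q - 1
       \<and> (\<Sum>w\<in>(SO_plus :: ('a ^ (2 + 2) ^ (2 + 2)) set). \<psi> (trace w))
           = of_nat q ^ 2 * (kloosterman_sum \<psi> 1 ^ 2 + of_nat q ^ 3 - of_nat q)"
proof -
  have "(2 :: 'a) = 0" using two_eq_0_if_card_power_2 assms(1,2) by blast
  then show ?thesis
    using sum_SO_plus_1[of \<psi>] sum_O_plus_1[of \<psi>] sum_SO_plus_2[of \<psi>] assms(2,3)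
    by (simp add: nontrivial_additive_character_def)
qed

end
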